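(* Let $x_1<x_2<\dots<x_n$ and $y_1<y_2<\dots<y_n$ be real numbers with $\sum_{i=1}^n x_i=\sum_{i=1}^n y_i=0$, and let $\mu=n^{-1}\sum_{i=1}^n\delta_{x_i}$ and $\nu=n^{-1}\sum_{i=1}^n\delta_{y_i}$. Let $\mathcal S^\star\subset S_n$ be the set of minimizers of $$\min_{\sigma\in S_n}\ \frac1{n^2}\sum_{i=1}^n\sum_{j=1}^n\Big||x_i-x_j|^2-|y_{\sigma(i)}-y_{\sigma(j)}|^2\Big|^2,$$ and let $\mathcal A^\star\subset[0.5W_-,0.5W_+]$ be the set of minimizers of $$\inf_{a\in[0.5W_-,\,0.5W_+]}\ \Big\{32a^2+\inf_{\pi\in\Pi(\mu,\nu)}\int\big(-4x^2y^2-32axy\big)\,d\pi(x,y)\Big\}.$$ Then $\mathcal A^\star\subset\{0.5W_-,0.5W_+\}$ if and only if $\mathcal S^\star\subset\{\mathrm{id},\overline{\mathrm{id}}\}$.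
   Context: $S_n$ is the symmetric group on $\{1,\dots,n\}$; $\mathrm{id}(i)=i$ is the identity permutation and $\overline{\mathrm{id}}(i)=n-i+1$ is the anti-identity permutation. $\Pi(\mu,\nu)$ is the set of couplings of $\mu$ and $\nu$. $W_-:=\inf_{\pi\in\Pi(\mu,\nu)}\int xy\,d\pi(x,y)$ and $W_+:=\sup_{\pi\in\Pi(\mu,\nu)}\int xy\,d\pi(x,y)$. The first minimization equals $\mathsf D(\mu,\nu)^2$, where $\mathsf D(\mu,\nu)^2=\inf_{\pi\in\Pi(\mu,\nu)}\iint\big||x-x'|^2-|y-y'|^2\big|^2\,d\pi\otimes\pi(x,y,x',y')$ is the squared $(2,2)$-Gromov-Wasserstein distance (for uniform distributions on $n$ distinct points of $\mathbb R$ it suffices to optimize over couplings induced by permutations; this is a known fact). The second infimum equals $\mathsf S^2(\mu,\nu)$, the coupling-dependent term in the decomposition $\mathsf D(\mu,\nu)^2=\mathsf S^1(\mu,\nu)+\mathsf S^2(\mu,\nu)$ valid for centered measures, where $\mathsf S^1(\mu,\nu)$ depends only on the marginals and $\mathsf S^2(\mu,\nu)=\inf_{\pi\in\Pi(\mu,\nu)}\int-4x^2y^2\,d\pi(x,y)-8\big(\int xy\,d\pi(x,y)\big)^2$. *)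

theory Defs
  imports "HOL-Probability.Probability" "HOL-Combinatorics.Permutations"
begin

definition empirical_measure :: "nat \<Rightarrow> (nat \<Rightarrow> real) \<Rightarrow> real measure" where
  "empirical_measure n x =
     measure_of UNIV (sets borel)
       (\<lambda>A. inverse (of_nat n) * (\<Sum>i=1..n. emeasure (return borel (x i)) A))"

(* The set function handed to measure_of is a measure, so it is not replaced by the zero measure. *)
lemma emeasure_empirical_measure:
  assumes "A \<in> sets borel"
  shows "emeasure (empirical_measure n x) A =
           inverse (of_nat n) * (\<Sum>i=1..n. indicator A (x i))"
proof -
  let ?m = "\<lambda>A. inverse (of_nat n :: ennreal) * (\<Sum>i=1..n. emeasure (return borel (x i)) A)"
  have "emeasure (empirical_measure n x) A = ?m A"
  proof (rule emeasure_measure_of[OF empirical_measure_def])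
    show "sets borel \<subseteq> Pow (UNIV :: real set)" by simp
    have sets: "sets (empirical_measure n x) = sets borel"
      unfolding empirical_measure_def by (metis sets.sets_measure_of_eq space_borel)
    show "A \<in> sets (empirical_measure n x)" using assms sets by simp
    show "positive (sets (empirical_measure n x)) ?m"
      by (simp add: positive_def)
    show "countably_additive (sets (empirical_measure n x)) ?m"
      unfolding sets
    proof (rule countably_additiveI)
      fix B :: "nat \<Rightarrow> real set"
      assume B: "range B \<subseteq> sets borel" "disjoint_family B"
      have "(\<Sum>k. ?m (B k)) = inverse (of_nat n) * (\<Sum>i=1..n. \<Sum>k. emeasure (return borel (x i)) (B k))"
        by (simp add: suminf_sum)
      also have "\<dots> = ?m (\<Union> (range B))"
        using B by (simp add: suminf_emeasure del: emeasure_return)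
      finally show "(\<Sum>k. ?m (B k)) = ?m (\<Union> (range B))" .
    qed
  qed
  also have "\<dots> = inverse (of_nat n) * (\<Sum>i=1..n. indicator A (x i))"
    using assms by simp
  finally show ?thesis .
qed

definition couplings :: "real measure \<Rightarrow> real measure \<Rightarrow> (real \<times> real) measure set" where
  "couplings \<mu> \<nu> =
     {\<pi>. sets \<pi> = sets borel \<and> distr \<pi> borel fst = \<mu> \<and> distr \<pi> borel snd = \<nu>}"

(* Integrals and infima below are real-valued. For finitely supported probability marginals every
   coupling is concentrated on a finite set, so the integrands are integrable and the sets of
   values are nonempty and bounded. *)

definition W_minus :: "real measure \<Rightarrow> real measure \<Rightarrow> real" where
  "W_minus \<mu> \<nu> = (INF \<pi>\<in>couplings \<mu> \<nu>. \<integral>(x, y). x * y \<partial>\<pi>)"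

definition W_plus :: "real measure \<Rightarrow> real measure \<Rightarrow> real" where
  "W_plus \<mu> \<nu> = (SUP \<pi>\<in>couplings \<mu> \<nu>. \<integral>(x, y). x * y \<partial>\<pi>)"

definition dual_objective :: "real measure \<Rightarrow> real measure \<Rightarrow> real \<Rightarrow> real" where
  "dual_objective \<mu> \<nu> a =
     32 * a\<^sup>2 + (INF \<pi>\<in>couplings \<mu> \<nu>. \<integral>(x, y). - 4 * x\<^sup>2 * y\<^sup>2 - 32 * a * x * y \<partial>\<pi>)"

definition dual_minimizers :: "real measure \<Rightarrow> real measure \<Rightarrow> real set" where
  "dual_minimizers \<mu> \<nu> =
     {a. is_arg_min (dual_objective \<mu> \<nu>)
           (\<lambda>a. a \<in> {0.5 * W_minus \<mu> \<nu> .. 0.5 * W_plus \<mu> \<nu>}) a}"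

definition qap_objective ::
    "nat \<Rightarrow> (nat \<Rightarrow> real) \<Rightarrow> (nat \<Rightarrow> real) \<Rightarrow> (nat \<Rightarrow> nat) \<Rightarrow> real" where
  "qap_objective n x y \<sigma> =
     1 / (real n)\<^sup>2 *
       (\<Sum>i=1..n. \<Sum>j=1..n. \<bar>\<bar>x i - x j\<bar>\<^sup>2 - \<bar>y (\<sigma> i) - y (\<sigma> j)\<bar>\<^sup>2\<bar>\<^sup>2)"

definition qap_minimizers ::
    "nat \<Rightarrow> (nat \<Rightarrow> real) \<Rightarrow> (nat \<Rightarrow> real) \<Rightarrow> (nat \<Rightarrow> nat) set" where
  "qap_minimizers n x y =
     {\<sigma>. is_arg_min (qap_objective n x y) (\<lambda>\<sigma>. \<sigma> permutes {1..n}) \<sigma>}"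

(* Fixes every point outside {1..n}, as "permutes" demands. *)
definition anti_id :: "nat \<Rightarrow> nat \<Rightarrow> nat" where
  "anti_id n i = (if i \<in> {1..n} then n - i + 1 else i)"

end

theory Submission
  imports Defs "HOL-Combinatorics.Cycles"
begin

text \<open>
  For a permutation \<open>\<sigma>\<close> put \<open>U \<sigma> = (\<Sum>i=1..n. x i * y (\<sigma> i)) / n\<close>,
  \<open>V \<sigma> = (\<Sum>i=1..n. (x i)\<^sup>2 * (y (\<sigma> i))\<^sup>2) / n\<close> and \<open>g \<sigma> = - 4 V \<sigma> - 8 (U \<sigma>)\<^sup>2\<close>.
  Since \<open>x\<close> and \<open>y\<close> are centered, expanding the squares shows that the quadratic assignment
  objective is \<open>C + g \<sigma>\<close> with a constant \<open>C\<close> (\<open>qap_objective_eq\<close>).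

  A coupling of the two uniform measures is a matrix with all row and column sums \<open>1/n\<close>. A linear
  cost on such matrices is minimized by a permutation (\<open>optimal_assignment\<close>), so the infimum over
  couplings of the integral of a Borel function is a minimum over permutations (\<open>INF_couplings_attained\<close>). Consequently
  the dual objective \<open>D a\<close> is the minimum over \<open>\<sigma>\<close> of
  \<open>32 * a\<^sup>2 - 4 * V \<sigma> - 32 * a * U \<sigma> = g \<sigma> + 32 * (a - U \<sigma> / 2)\<^sup>2\<close>.
  As \<open>U \<sigma> / 2\<close> always lies in the interval over which \<open>D\<close> is minimized, minimizing over \<open>a\<close> first shows
  that the dual minimizers are exactly the numbers \<open>U \<sigma> / 2\<close>, where \<open>\<sigma>\<close> runs through the minimizers
  of \<open>g\<close>, that is, of the assignment objective.

  The strict rearrangement inequality says that \<open>U\<close> attains its maximum only at \<open>id\<close> and its minimum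
  only at \<open>anti_id n\<close>. So \<open>W_plus\<close> and \<open>W_minus\<close> are \<open>U id\<close> and \<open>U (anti_id n)\<close>, and \<open>U \<sigma> / 2\<close> is an
  endpoint of the interval precisely when \<open>\<sigma>\<close> is one of these two permutations.
\<close>

section \<open>Optimal assignments and potentials\<close>

text \<open>Total length of a walk, given as its list of vertices, when \<open>d i j\<close> is the length of the step
  from \<open>i\<close> to \<open>j\<close>.\<close>

fun path_weight :: "('a \<Rightarrow> 'a \<Rightarrow> real) \<Rightarrow> 'a list \<Rightarrow> real" where
  "path_weight d (i # j # vs) = d i j + path_weight d (j # vs)"
| "path_weight d vs = 0"

lemma path_weight_append:
  "path_weight d (us @ i # vs) = path_weight d (us @ [i]) + path_weight d (i # vs)"
  by (induction us rule: induct_list012) auto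

lemma path_weight_closed:
  "path_weight d (i # vs @ [j]) = sum_list (map2 d (i # vs) (vs @ [j]))"
  by (induction vs arbitrary: i) auto

text \<open>A simple closed walk is a cyclic permutation, which fixes, at no cost, all vertices off the walk.\<close>

lemma closed_path_weight_nonneg:
  assumes "finite S" and diag: "\<And>i. i \<in> S \<Longrightarrow> d i i = 0"
    and perm: "\<And>\<tau>. \<tau> permutes S \<Longrightarrow> 0 \<le> (\<Sum>i\<in>S. d i (\<tau> i))"
    and vs: "distinct (i # vs)" "set (i # vs) \<subseteq> S"
  shows "0 \<le> path_weight d (i # vs @ [i])"
proof -
  define \<tau> where "\<tau> = cycle_of_list (i # vs)"
  have rot: "map \<tau> (i # vs) = vs @ [i]"
    unfolding \<tau>_def using cyclic_rotation[OF vs(1), of 1] by simp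
  have \<tau>: "\<tau> permutes set (i # vs)"
    unfolding \<tau>_def by (rule cycle_permutes)
  have map2: "map2 d us (map \<tau> us) = map (\<lambda>k. d k (\<tau> k)) us" for us
    by (induction us) auto
  have "path_weight d (i # vs @ [i]) = sum_list (map2 d (i # vs) (map \<tau> (i # vs)))"
    unfolding rot by (rule path_weight_closed)
  also have "\<dots> = sum_list (map (\<lambda>k. d k (\<tau> k)) (i # vs))"
    unfolding map2 ..
  also have "\<dots> = (\<Sum>k\<in>set (i # vs). d k (\<tau> k))"
    using vs(1) by (simp only: sum_list_distinct_conv_sum_set)
  also have "\<dots> = (\<Sum>k\<in>S. d k (\<tau> k))"
    using assms(1) vs(2) \<tau> diag by (intro sum.mono_neutral_left) (auto simp: permutes_not_in)
  also have "\<dots> \<ge> 0"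
    using \<tau> vs(2) by (intro perm) (rule permutes_subset)
  finally show ?thesis .
qed

text \<open>Without negative cycles, the length of a shortest simple path starting at \<open>i\<close>, with free end
  point, is a potential.\<close>

lemma potential_exists:
  assumes "finite S" and diag: "\<And>i. i \<in> S \<Longrightarrow> d i i = 0"
    and perm: "\<And>\<tau>. \<tau> permutes S \<Longrightarrow> 0 \<le> (\<Sum>i\<in>S. d i (\<tau> i))"
  obtains \<phi> :: "'a \<Rightarrow> real" where "\<And>i j. i \<in> S \<Longrightarrow> j \<in> S \<Longrightarrow> \<phi> i \<le> d i j + \<phi> j"
proof
  define Q where "Q i = {i # vs | vs. distinct (i # vs) \<and> set (i # vs) \<subseteq> S}" for i
  define \<phi> where "\<phi> i = Min (path_weight d ` Q i)" for i
  have fin: "finite (Q i)" for i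
  proof (rule finite_subset)
    show "Q i \<subseteq> {vs. set vs \<subseteq> S \<and> distinct vs}" by (auto simp: Q_def)
    show "finite {vs. set vs \<subseteq> S \<and> distinct vs}" 
      using assms(1) by (rule finite_subset_distinct)
  qed
  fix i j assume i: "i \<in> S" and j: "j \<in> S"
  have "Q j \<noteq> {}" using j by (auto simp: Q_def intro!: exI[of _ "[]"])
  then have "\<phi> j \<in> path_weight d ` Q j"
    unfolding \<phi>_def using fin by (intro Min_in) auto
  then obtain vs where vs: "distinct (j # vs)" "set (j # vs) \<subseteq> S" "\<phi> j = path_weight d (j # vs)"
    by (auto simp: Q_def)
  have upper: "\<phi> i \<le> path_weight d (i # us)" if "distinct (i # us)" "set (i # us) \<subseteq> S" for us
  proof -
    have "i # us \<in> Q i" using that by (auto simp: Q_def)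
    then show ?thesis unfolding \<phi>_def using fin[of i] by (intro Min_le) auto
  qed
  show "\<phi> i \<le> d i j + \<phi> j"
  proof (cases "i \<in> set (j # vs)")
    case False
    then show ?thesis using upper[of "j # vs"] vs i by simp
  next
    case True
    \<comment> \<open>The path from \<open>j\<close> returns to \<open>i\<close>: drop the closed walk through \<open>i\<close> and \<open>j\<close>, of length at
      least \<open>0\<close>, and keep the tail starting at \<open>i\<close>.\<close>
    then obtain us ws where split: "j # vs = us @ i # ws"
      by (meson split_list)
    have "distinct (us @ i # ws)" "set (us @ i # ws) \<subseteq> S"
      using vs(1,2) unfolding split by auto
    then have tail: "\<phi> i \<le> path_weight d (i # ws)" and us: "distinct (i # us)" "set (i # us) \<subseteq> S"
      using upper[of ws] by auto
    show ?thesis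
    proof (cases us)
      case Nil
      then show ?thesis using split diag i by simp
    next
      case (Cons k us')
      then have "k = j" using split by simp
      have "0 \<le> path_weight d (i # us @ [i])"
        using closed_path_weight_nonneg[of S d i us] assms us by blast
      also have "\<dots> = d i j + path_weight d (us @ [i])"
        using Cons \<open>k = j\<close> by simp
      finally show ?thesis
        using tail vs(3) path_weight_append[of d us i ws] split by simp
    qed
  qed
qed

lemma permutes_minimizer:
  fixes F :: "('a \<Rightarrow> 'a) \<Rightarrow> real"
  assumes "finite S"
  obtains \<sigma> where "\<sigma> permutes S" "\<And>\<tau>. \<tau> permutes S \<Longrightarrow> F \<sigma> \<le> F \<tau>"
proof -
  have "finite {\<sigma>. \<sigma> permutes S}" "id \<in> {\<sigma>. \<sigma> permutes S}"
    using assms by (simp_all add: finite_permutations permutes_id)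
  then obtain \<sigma> where "is_arg_min F (\<lambda>\<sigma>. \<sigma> \<in> {\<sigma>. \<sigma> permutes S}) \<sigma>"
    using ex_is_arg_min_if_finite by blast
  then show ?thesis
    using that[of \<sigma>] by (auto simp: is_arg_min_def not_less)
qed

text \<open>The consequence of the Birkhoff-von Neumann theorem that is needed: a linear cost on nonnegative
  matrices with constant row and column sums is minimized by a multiple of a permutation matrix.
  The proof is linear programming duality. Relabeling the columns by an optimal permutation \<open>\<sigma>\<close>
  leaves no negative cycle, and a potential \<open>\<phi>\<close> for the relabeled costs bounds each \<open>c i (\<sigma> j)\<close>
  from below by \<open>c i (\<sigma> i) + \<phi> i - \<phi> j\<close>. The potential terms cancel when summed against the matrix.\<close>

lemma optimal_assignment:
  fixes c P :: "'a \<Rightarrow> 'a \<Rightarrow> real"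
  assumes "finite S" and nonneg: "\<And>i j. i \<in> S \<Longrightarrow> j \<in> S \<Longrightarrow> 0 \<le> P i j"
    and row: "\<And>i. i \<in> S \<Longrightarrow> (\<Sum>j\<in>S. P i j) = s"
    and col: "\<And>j. j \<in> S \<Longrightarrow> (\<Sum>i\<in>S. P i j) = s"
  obtains \<sigma> where "\<sigma> permutes S" "s * (\<Sum>i\<in>S. c i (\<sigma> i)) \<le> (\<Sum>i\<in>S. \<Sum>j\<in>S. c i j * P i j)"
proof -
  obtain \<sigma> where \<sigma>: "\<sigma> permutes S"
    and min: "\<And>\<tau>. \<tau> permutes S \<Longrightarrow> (\<Sum>i\<in>S. c i (\<sigma> i)) \<le> (\<Sum>i\<in>S. c i (\<tau> i))"
    using permutes_minimizer[OF assms(1), of "\<lambda>\<sigma>. \<Sum>i\<in>S. c i (\<sigma> i)"] by blast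
  define d where "d i j = c i (\<sigma> j) - c i (\<sigma> i)" for i j
  have "0 \<le> (\<Sum>i\<in>S. d i (\<tau> i))" if "\<tau> permutes S" for \<tau>
    using min[OF permutes_compose[OF that \<sigma>]] by (simp add: d_def sum_subtractf)
  then obtain \<phi> where \<phi>: "\<And>i j. i \<in> S \<Longrightarrow> j \<in> S \<Longrightarrow> \<phi> i \<le> d i j + \<phi> j"
    using potential_exists[of S d] assms(1) by (auto simp: d_def)
  have row': "(\<Sum>j\<in>S. P i (\<sigma> j)) = s" if "i \<in> S" for i
    using row[OF that] sum.permute[OF \<sigma>, of "P i"] by (simp add: o_def)
  have col': "(\<Sum>i\<in>S. P i (\<sigma> j)) = s" if "j \<in> S" for j
    using col that \<sigma> by (simp add: permutes_in_image)
  have "s * (\<Sum>i\<in>S. c i (\<sigma> i)) =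
      (\<Sum>i\<in>S. (c i (\<sigma> i) + \<phi> i) * (\<Sum>j\<in>S. P i (\<sigma> j))) - (\<Sum>j\<in>S. \<phi> j * (\<Sum>i\<in>S. P i (\<sigma> j)))"
    by (simp add: row' col' sum_distrib_left sum.distrib algebra_simps)
  also have "(\<Sum>j\<in>S. \<phi> j * (\<Sum>i\<in>S. P i (\<sigma> j))) = (\<Sum>i\<in>S. \<Sum>j\<in>S. \<phi> j * P i (\<sigma> j))"
    by (subst sum.swap) (simp add: sum_distrib_left)
  also have "(\<Sum>i\<in>S. (c i (\<sigma> i) + \<phi> i) * (\<Sum>j\<in>S. P i (\<sigma> j))) - \<dots> =
      (\<Sum>i\<in>S. \<Sum>j\<in>S. (c i (\<sigma> i) + \<phi> i - \<phi> j) * P i (\<sigma> j))"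
    by (simp add: sum_distrib_left sum_subtractf[symmetric] left_diff_distrib)
  also have "\<dots> \<le> (\<Sum>i\<in>S. \<Sum>j\<in>S. c i (\<sigma> j) * P i (\<sigma> j))"
  proof (intro sum_mono mult_right_mono)
    fix i j assume "i \<in> S" "j \<in> S"
    then show "c i (\<sigma> i) + \<phi> i - \<phi> j \<le> c i (\<sigma> j)" "0 \<le> P i (\<sigma> j)"
      using \<phi>[of i j] nonneg \<sigma> by (auto simp: d_def permutes_in_image)
  qed
  also have "\<dots> = (\<Sum>i\<in>S. \<Sum>j\<in>S. c i j * P i j)"
    using sum.permute[OF \<sigma>, of "\<lambda>j. c i j * P i j" for i] by (simp add: o_def)
  finally show ?thesis using that \<sigma> by blast
qed

section \<open>Couplings of empirical measures\<close>

lemma empirical_measure_eq_distr: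
  assumes "n \<ge> 1"
  shows "empirical_measure n x = distr (measure_pmf (pmf_of_set {1..n})) borel x"
proof (rule measure_eqI)
  have sets: "sets (empirical_measure n x) = sets borel"
    unfolding empirical_measure_def by (metis sets.sets_measure_of_eq space_borel)
  then show "sets (empirical_measure n x) = sets (distr (measure_pmf (pmf_of_set {1..n})) borel x)"
    by simp
  fix A assume "A \<in> sets (empirical_measure n x)"
  then have A: "A \<in> sets borel" using sets by simp
  have "(\<Sum>i=1..n. indicator A (x i) :: ennreal) = of_nat (card ({1..n} \<inter> x -` A))"
    by (simp add: indicator_def sum.If_cases Int_def vimage_def)
  moreover have "emeasure (distr (measure_pmf (pmf_of_set {1..n})) borel x) A =
      of_nat (card ({1..n} \<inter> x -` A)) / of_nat n"
    using assms A by (simp add: emeasure_distr emeasure_pmf_of_set divide_ennreal ennreal_of_nat_eq_real_of_nat)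
  ultimately show "emeasure (empirical_measure n x) A =
      emeasure (distr (measure_pmf (pmf_of_set {1..n})) borel x) A"
    using A by (simp add: emeasure_empirical_measure divide_ennreal_def mult.commute)
qed

text \<open>The integral of \<open>f\<close> against the coupling that pairs \<open>x i\<close> with \<open>y (\<sigma> i)\<close>.\<close>

definition permutation_mean ::
    "nat \<Rightarrow> (nat \<Rightarrow> real) \<Rightarrow> (nat \<Rightarrow> real) \<Rightarrow> (real \<times> real \<Rightarrow> real) \<Rightarrow> (nat \<Rightarrow> nat) \<Rightarrow> real" where
  "permutation_mean n x y f \<sigma> = (\<Sum>i=1..n. f (x i, y (\<sigma> i))) / n"

lemma permutation_coupling:
  assumes "n \<ge> 1" "\<sigma> permutes {1..n}" and [measurable]: "f \<in> borel_measurable borel"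
  obtains \<pi> where "\<pi> \<in> couplings (empirical_measure n x) (empirical_measure n y)"
    "integral\<^sup>L \<pi> f = permutation_mean n x y f \<sigma>"
proof
  define p where "p = pmf_of_set {1..n}"
  define \<pi> where "\<pi> = distr (measure_pmf p) borel (\<lambda>i. (x i, y (\<sigma> i)))"
  have "map_pmf \<sigma> p = p"
    unfolding p_def using assms permutes_inj_on[OF assms(2)] permutes_image[OF assms(2)] 
    by (simp add: map_pmf_of_set_inj)
  then have p: "distr (measure_pmf p) (count_space UNIV) \<sigma> = measure_pmf p"
    by (metis map_pmf_rep_eq)
  have "distr (measure_pmf p) borel (\<lambda>i. y (\<sigma> i)) =
      distr (distr (measure_pmf p) (count_space UNIV) \<sigma>) borel y"
    by (simp add: distr_distr o_def)
  then have "distr (measure_pmf p) borel (\<lambda>i. y (\<sigma> i)) = empirical_measure n y"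
    unfolding p using assms(1) by (simp add: empirical_measure_eq_distr p_def)
  moreover have "distr \<pi> borel fst = distr (measure_pmf p) borel x"
    unfolding \<pi>_def by (subst distr_distr) (auto simp: o_def borel_prod[symmetric] space_pair_measure)
  moreover have "distr \<pi> borel snd = distr (measure_pmf p) borel (\<lambda>i. y (\<sigma> i))"
    unfolding \<pi>_def by (subst distr_distr) (auto simp: o_def borel_prod[symmetric] space_pair_measure)
  ultimately show "\<pi> \<in> couplings (empirical_measure n x) (empirical_measure n y)"
    using assms(1) by (simp add: couplings_def empirical_measure_eq_distr p_def) (simp add: \<pi>_def)
  show "integral\<^sup>L \<pi> f = permutation_mean n x y f \<sigma>"
    unfolding \<pi>_def p_def permutation_mean_def using assms(1)
    by (subst integral_distr) (auto simp: integral_pmf_of_set)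
qed


lemma coupling_marginal:
  assumes "n \<ge> 1" and [measurable]: "h \<in> borel_measurable \<pi>" and [measurable]: "A \<in> sets borel"
    and "space \<pi> = UNIV" and "distr \<pi> borel h = empirical_measure n x"
  shows "measure \<pi> (h -` A) = card ({1..n} \<inter> x -` A) / n"
proof -
  have "measure \<pi> (h -` A) = measure (distr \<pi> borel h) A"
    using assms(4) by (simp add: measure_distr)
  also have "\<dots> = measure (measure_pmf (pmf_of_set {1..n})) (x -` A)"
    using assms(1,5) by (simp add: empirical_measure_eq_distr measure_distr)
  finally show ?thesis
    using assms(1) by (simp add: measure_pmf_of_set)
qed

text \<open>A coupling is concentrated on the grid of the points \<open>(x i, y j)\<close>. Its masses there form a
  matrix with row and column sums \<open>1 / n\<close>, to which \<open>optimal_assignment\<close> applies.\<close>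

lemma coupling_integral_ge_permutation:
  assumes n: "n \<ge> 1" and inj: "inj_on x {1..n}" "inj_on y {1..n}"
    and \<pi>: "\<pi> \<in> couplings (empirical_measure n x) (empirical_measure n y)"
    and f: "f \<in> borel_measurable borel"
  obtains \<sigma> where "\<sigma> permutes {1..n}" "permutation_mean n x y f \<sigma> \<le> integral\<^sup>L \<pi> f"
proof -
  have [measurable_cong]: "sets \<pi> = sets borel"
    and fst: "distr \<pi> borel fst = empirical_measure n x"
    and snd: "distr \<pi> borel snd = empirical_measure n y"
    using \<pi> by (auto simp: couplings_def)
  have space: "space \<pi> = UNIV"
    using sets_eq_imp_space_eq[OF \<open>sets \<pi> = sets borel\<close>] by simp
  have [measurable]: "fst \<in> borel_measurable \<pi>" "snd \<in> borel_measurable \<pi>"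
    by (auto simp: measurable_cong_sets[OF \<open>sets \<pi> = sets borel\<close> refl] borel_prod[symmetric])
  note f[measurable]
  have "prob_space (distr \<pi> borel fst)"
    unfolding fst using n by (simp add: empirical_measure_eq_distr measure_pmf.prob_space_distr)
  then interpret prob_space \<pi>
    by (rule prob_space_distrD[rotated]) measurable
  define S where "S = {1..n}"
  have S: "finite S" "card S = n" by (auto simp: S_def)
  have marg: "measure \<pi> (fst -` A) = card (S \<inter> x -` A) / n"
    "measure \<pi> (snd -` A) = card (S \<inter> y -` A) / n" if "A \<in> sets borel" for A
    using coupling_marginal[OF n _ that space] fst snd by (auto simp: S_def)
  have "S \<inter> x -` x ` S = S" "S \<inter> y -` y ` S = S" by auto
  moreover have "x ` S \<in> sets borel" "y ` S \<in> sets borel"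
    using S by (auto intro!: borel_closed finite_imp_closed)
  ultimately have "prob (fst -` x ` S) = 1" "prob (snd -` y ` S) = 1"
    using n S marg by auto
  then have AE: "AE p in \<pi>. fst p \<in> x ` S" "AE p in \<pi>. snd p \<in> y ` S"
    using AE_prob_1[of "fst -` x ` S"] AE_prob_1[of "snd -` y ` S"] by auto
  define P where "P i j = prob {(x i, y j)}" for i j
  have row: "(\<Sum>j\<in>S. P i j) = 1 / n" if "i \<in> S" for i
  proof -
    have "disjoint_family_on (\<lambda>j. {(x i, y j)}) S"
      using inj by (auto simp: disjoint_family_on_def S_def dest: inj_onD)
    moreover have "(\<lambda>j. {(x i, y j)}) ` S \<subseteq> events" by auto
    ultimately have "(\<Sum>j\<in>S. P i j) = prob (\<Union>j\<in>S. {(x i, y j)})"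
      unfolding P_def using finite_measure_finite_Union[OF S(1)] by simp
    also have "\<dots> = prob (fst -` {x i})"
    proof (rule finite_measure_eq_AE)
      show "AE p in \<pi>. p \<in> (\<Union>j\<in>S. {(x i, y j)}) \<longleftrightarrow> p \<in> fst -` {x i}"
        using AE(2) by eventually_elim auto
      show "fst -` {x i} \<in> events"
        using measurable_sets[of fst \<pi> borel "{x i}"] by (simp add: space)
      show "(\<Union>j\<in>S. {(x i, y j)}) \<in> events"
        using S by (intro sets.finite_UN) auto
    qed
    also have "\<dots> = 1 / n"
    proof -
      have "S \<inter> x -` {x i} = {i}"
        using that inj by (auto simp: S_def dest: inj_onD)
      then show ?thesis by (simp add: marg)
    qed
    finally show ?thesis .
  qed
  have col: "(\<Sum>i\<in>S. P i j) = 1 / n" if "j \<in> S" for j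
  proof -
    have "disjoint_family_on (\<lambda>i. {(x i, y j)}) S"
      using inj by (auto simp: disjoint_family_on_def S_def dest: inj_onD)
    moreover have "(\<lambda>i. {(x i, y j)}) ` S \<subseteq> events" by auto
    ultimately have "(\<Sum>i\<in>S. P i j) = prob (\<Union>i\<in>S. {(x i, y j)})"
      unfolding P_def using finite_measure_finite_Union[OF S(1)] by simp
    also have "\<dots> = prob (snd -` {y j})"
    proof (rule finite_measure_eq_AE)
      show "AE p in \<pi>. p \<in> (\<Union>i\<in>S. {(x i, y j)}) \<longleftrightarrow> p \<in> snd -` {y j}"
        using AE(1) by eventually_elim auto
      show "snd -` {y j} \<in> events"
        using measurable_sets[of snd \<pi> borel "{y j}"] by (simp add: space)
      show "(\<Union>i\<in>S. {(x i, y j)}) \<in> events"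
        using S by (intro sets.finite_UN) auto
    qed
    also have "\<dots> = 1 / n"
    proof -
      have "S \<inter> y -` {y j} = {j}"
        using that inj by (auto simp: S_def dest: inj_onD)
      then show ?thesis by (simp add: marg)
    qed
    finally show ?thesis .
  qed
  define G where "G = x ` S \<times> y ` S"
  have "finite G" by (simp add: G_def S)
  have "integral\<^sup>L \<pi> f = (\<integral>p. (\<Sum>g\<in>G. f g * indicator {g} p) \<partial>\<pi>)"
  proof (rule integral_cong_AE)
    show "AE p in \<pi>. f p = (\<Sum>g\<in>G. f g * indicator {g} p)"
      using AE
    proof eventually_elim
      case (elim p)
      then have "p \<in> G" by (cases p) (simp add: G_def)
      have "(\<Sum>g\<in>G. f g * indicator {g} p) = (\<Sum>g\<in>G. if g = p then f p else 0)"
        by (intro sum.cong) (auto simp: indicator_def)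
      then show ?case using \<open>p \<in> G\<close> \<open>finite G\<close> by simp
    qed
  qed auto
  also have "\<dots> = (\<Sum>g\<in>G. f g * prob {g})"
    by (subst Bochner_Integration.integral_sum) (auto simp: emeasure_eq_measure)
  also have "\<dots> = (\<Sum>i\<in>S. \<Sum>j\<in>S. f (x i, y j) * P i j)"
    using inj by (simp add: G_def P_def sum.cartesian_product' sum.reindex S_def)
  finally have "integral\<^sup>L \<pi> f = \<dots>" .
  moreover obtain \<sigma> where "\<sigma> permutes S"
    "1 / n * (\<Sum>i\<in>S. f (x i, y (\<sigma> i))) \<le> (\<Sum>i\<in>S. \<Sum>j\<in>S. f (x i, y j) * P i j)"
    using optimal_assignment[OF S(1) _ row col, of "\<lambda>i j. f (x i, y j)"] by (auto simp: P_def)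
  ultimately show ?thesis
    using that by (auto simp: permutation_mean_def S_def)
qed

lemma INF_couplings_attained:
  assumes n: "n \<ge> 1" and inj: "inj_on x {1..n}" "inj_on y {1..n}"
    and f: "f \<in> borel_measurable borel"
  obtains \<sigma> where "\<sigma> permutes {1..n}"
    "(INF \<pi>\<in>couplings (empirical_measure n x) (empirical_measure n y). integral\<^sup>L \<pi> f) =
      permutation_mean n x y f \<sigma>"
    "\<And>\<tau>. \<tau> permutes {1..n} \<Longrightarrow> permutation_mean n x y f \<sigma> \<le> permutation_mean n x y f \<tau>"
proof -
  obtain \<sigma> where \<sigma>: "\<sigma> permutes {1..n}"
    and min: "\<And>\<tau>. \<tau> permutes {1..n} \<Longrightarrow> permutation_mean n x y f \<sigma> \<le> permutation_mean n x y f \<tau>"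
    using permutes_minimizer[of "{1..n}" "permutation_mean n x y f"] by blast
  obtain \<pi> where \<pi>: "\<pi> \<in> couplings (empirical_measure n x) (empirical_measure n y)"
    "integral\<^sup>L \<pi> f = permutation_mean n x y f \<sigma>"
    using permutation_coupling[OF n \<sigma> f] .
  have "(INF \<pi>\<in>couplings (empirical_measure n x) (empirical_measure n y). integral\<^sup>L \<pi> f) =
      permutation_mean n x y f \<sigma>"
  proof (rule cInf_eq_minimum)
    show "permutation_mean n x y f \<sigma> \<in>
        (\<lambda>\<pi>. integral\<^sup>L \<pi> f) ` couplings (empirical_measure n x) (empirical_measure n y)"
      using \<pi> by force
    fix v assume "v \<in> (\<lambda>\<pi>. integral\<^sup>L \<pi> f) ` couplings (empirical_measure n x) (empirical_measure n y)"
    then obtain \<pi>' where "\<pi>' \<in> couplings (empirical_measure n x) (empirical_measure n y)"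
      and v: "v = integral\<^sup>L \<pi>' f"
      by blast
    then obtain \<tau> where "\<tau> permutes {1..n}" "permutation_mean n x y f \<tau> \<le> v"
      using coupling_integral_ge_permutation[OF n inj _ f] by blast
    then show "permutation_mean n x y f \<sigma> \<le> v"
      using min by (meson order_trans)
  qed
  then show ?thesis using that \<sigma> min by blast
qed

section \<open>The rearrangement inequality\<close>

lemma rearrangement_strict:
  fixes x y :: "nat \<Rightarrow> real"
  assumes "finite S" and x: "strict_mono_on S x" and y: "strict_mono_on S y"
    and \<sigma>: "\<sigma> permutes S" "\<sigma> \<noteq> id"
  shows "(\<Sum>i\<in>S. x i * y (\<sigma> i)) < (\<Sum>i\<in>S. x i * y i)"
proof -
  have improve: "\<exists>\<rho>. \<rho> permutes S \<and> (\<Sum>i\<in>S. x i * y (\<tau> i)) < (\<Sum>i\<in>S. x i * y (\<rho> i))"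
    if \<tau>: "\<tau> permutes S" "\<tau> \<noteq> id" for \<tau>
  proof -
    \<comment> \<open>With \<open>k\<close> the first point moved and \<open>\<tau> j = k\<close>, the pair \<open>k < j\<close> is an inversion. Undoing
      it increases the sum.\<close>
    define k where "k = (LEAST k. \<tau> k \<noteq> k)"
    obtain i where "\<tau> i \<noteq> i" using \<tau>(2) by (auto simp: fun_eq_iff)
    then have k: "\<tau> k \<noteq> k" unfolding k_def by (rule LeastI)
    have less_k: "\<tau> i = i" if "i < k" for i
      using not_less_Least[of i "\<lambda>k. \<tau> k \<noteq> k"] that unfolding k_def by simp
    define j where "j = inv \<tau> k"
    have j: "\<tau> j = k"
      unfolding j_def using \<tau>(1) by (simp add: permutes_inverses)
    have "k < j" using k j less_k[of j] by (metis nat_neq_iff)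
    have "k < \<tau> k" using k less_k[of "\<tau> k"] permutes_inj[OF \<tau>(1)] by (metis injD nat_neq_iff)
    have kS: "k \<in> S" using k \<tau>(1) by (meson permutes_not_in)
    then have jS: "j \<in> S" "\<tau> k \<in> S" using j permutes_in_image[OF \<tau>(1)] by auto
    define \<rho> where "\<rho> = \<tau> \<circ> Transposition.transpose k j"
    have \<rho>: "\<rho> permutes S"
      unfolding \<rho>_def using kS jS \<tau>(1) by (intro permutes_compose permutes_swap_id)
    have split: "(\<Sum>i\<in>S. h i) = h k + h j + (\<Sum>i\<in>S - {k, j}. h i)" for h :: "nat \<Rightarrow> real"
    proof -
      have "S - {k, j} = S - {k} - {j}" by auto
      then show ?thesis
        using sum.remove[of S k h] sum.remove[of "S - {k}" j h] assms(1) kS jS \<open>k < j\<close> by simp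
    qed
    have "(\<Sum>i\<in>S - {k, j}. x i * y (\<rho> i)) = (\<Sum>i\<in>S - {k, j}. x i * y (\<tau> i))"
      by (intro sum.cong) (auto simp: \<rho>_def transpose_def)
    moreover have "0 < (x j - x k) * (y (\<tau> k) - y k)"
      using x y kS jS \<open>k < j\<close> \<open>k < \<tau> k\<close> by (intro mult_pos_pos) (auto simp: strict_mono_on_def)
    ultimately have "(\<Sum>i\<in>S. x i * y (\<tau> i)) < (\<Sum>i\<in>S. x i * y (\<rho> i))"
      unfolding split using j by (simp add: \<rho>_def algebra_simps)
    then show ?thesis using \<rho> by blast
  qed
  obtain \<rho> where \<rho>: "\<rho> permutes S"
    and max: "\<And>\<tau>. \<tau> permutes S \<Longrightarrow> (\<Sum>i\<in>S. x i * y (\<tau> i)) \<le> (\<Sum>i\<in>S. x i * y (\<rho> i))"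
    using permutes_minimizer[OF assms(1), of "\<lambda>\<sigma>. - (\<Sum>i\<in>S. x i * y (\<sigma> i))"] by auto
  have "\<rho> = id"
  proof (rule ccontr)
    assume "\<rho> \<noteq> id"
    then show False using improve[OF \<rho>] max by (meson not_less)
  qed
  moreover obtain \<tau> where "\<tau> permutes S" "(\<Sum>i\<in>S. x i * y (\<sigma> i)) < (\<Sum>i\<in>S. x i * y (\<tau> i))"
    using improve[OF \<sigma>] by blast
  ultimately show ?thesis
    using max[of \<tau>] by simp
qed

lemma anti_id_permutes: "anti_id n permutes {1..n}"
  by (rule bij_imp_permutes, rule bij_betw_byWitness[where f' = "anti_id n"]) (auto simp: anti_id_def)

lemma anti_id_involution: "anti_id n (anti_id n i) = i"
  by (auto simp: anti_id_def)

text \<open>Apply \<open>rearrangement_strict\<close> to the increasing sequence \<open>- y (anti_id n i)\<close>.\<close>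

lemma rearrangement_strict_anti:
  fixes x y :: "nat \<Rightarrow> real"
  assumes x: "strict_mono_on {1..n} x" and y: "strict_mono_on {1..n} y"
    and \<sigma>: "\<sigma> permutes {1..n}" "\<sigma> \<noteq> anti_id n"
  shows "(\<Sum>i=1..n. x i * y (anti_id n i)) < (\<Sum>i=1..n. x i * y (\<sigma> i))"
proof -
  have "anti_id n \<circ> \<sigma> \<noteq> id"
    using \<sigma>(2) anti_id_involution by (metis comp_apply ext id_apply)
  moreover have "strict_mono_on {1..n} (\<lambda>i. - y (anti_id n i))"
  proof (rule strict_mono_onI)
    fix r s assume "r \<in> {1..n}" "s \<in> {1..n}" "r < s"
    then have "anti_id n s < anti_id n r" "anti_id n s \<in> {1..n}" "anti_id n r \<in> {1..n}"
      by (auto simp: anti_id_def)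
    then show "- y (anti_id n r) < - y (anti_id n s)"
      using y by (simp add: strict_mono_on_def)
  qed
  ultimately show ?thesis
    using rearrangement_strict[OF _ x, of "\<lambda>i. - y (anti_id n i)" "anti_id n \<circ> \<sigma>"]
      permutes_compose[OF \<sigma>(1) anti_id_permutes]
    by (simp add: anti_id_involution sum_negf)
qed

section \<open>The quadratic assignment objective\<close>

lemma sum_squared_difference_products:
  fixes x z :: "'a \<Rightarrow> real"
  assumes "(\<Sum>i\<in>S. x i) = 0" "(\<Sum>i\<in>S. z i) = 0"
  shows "(\<Sum>i\<in>S. \<Sum>j\<in>S. (x i - x j)\<^sup>2 * (z i - z j)\<^sup>2) =
    2 * card S * (\<Sum>i\<in>S. (x i)\<^sup>2 * (z i)\<^sup>2) + 2 * (\<Sum>i\<in>S. (x i)\<^sup>2) * (\<Sum>i\<in>S. (z i)\<^sup>2)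
    + 4 * (\<Sum>i\<in>S. x i * z i)\<^sup>2"
proof -
  let ?A = "\<Sum>i\<in>S. (x i)\<^sup>2" and ?B = "\<Sum>i\<in>S. (z i)\<^sup>2" and ?V = "\<Sum>i\<in>S. (x i)\<^sup>2 * (z i)\<^sup>2"
    and ?U = "\<Sum>i\<in>S. x i * z i" and ?C = "\<Sum>i\<in>S. (x i)\<^sup>2 * z i" and ?D = "\<Sum>i\<in>S. x i * (z i)\<^sup>2"
  have "(\<Sum>j\<in>S. (x i - x j)\<^sup>2 * (z i - z j)\<^sup>2) =
      card S * ((x i)\<^sup>2 * (z i)\<^sup>2) + (x i)\<^sup>2 * ?B + (z i)\<^sup>2 * ?A + ?V
      - 2 * (z i * ?C) - 2 * (x i * ?D) + 4 * (x i * z i * ?U)" for i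
  proof -
    have "(\<Sum>j\<in>S. (x i - x j)\<^sup>2 * (z i - z j)\<^sup>2) =
      (\<Sum>j\<in>S. (x i)\<^sup>2 * (z i)\<^sup>2 + (x i)\<^sup>2 * (z j)\<^sup>2 + (z i)\<^sup>2 * (x j)\<^sup>2 + (x j)\<^sup>2 * (z j)\<^sup>2
        - 2 * (z i * ((x j)\<^sup>2 * z j)) - 2 * (x i * (x j * (z j)\<^sup>2)) + 4 * (x i * z i * (x j * z j))
        - 2 * (x i)\<^sup>2 * z i * z j - 2 * x i * (z i)\<^sup>2 * x j)"
      by (intro sum.cong) (auto simp: power2_eq_square algebra_simps)
    then show ?thesis
      by (simp add: sum.distrib sum_subtractf sum_distrib_left[symmetric] assms)
  qed
  then show ?thesis
    by (simp add: sum.distrib sum_subtractf sum_distrib_left[symmetric] sum_distrib_right[symmetric]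
      assms power2_eq_square)
qed

text \<open>The constant collects the terms that do not depend on the permutation.\<close>

lemma qap_objective_eq:
  assumes n: "n \<ge> 1" and x: "(\<Sum>i=1..n. x i) = 0" and y: "(\<Sum>i=1..n. y i) = 0"
  obtains C where "\<And>\<sigma>. \<sigma> permutes {1..n} \<Longrightarrow> qap_objective n x y \<sigma> =
      C - 4 * ((\<Sum>i=1..n. (x i)\<^sup>2 * (y (\<sigma> i))\<^sup>2) / n) - 8 * ((\<Sum>i=1..n. x i * y (\<sigma> i)) / n)\<^sup>2"
proof
  fix \<sigma> assume \<sigma>: "\<sigma> permutes {1..n}"
  define S where "S = {1..n}"
  note \<sigma> = \<sigma>[folded S_def]
  have perm: "(\<Sum>i\<in>S. h (\<sigma> i)) = (\<Sum>i\<in>S. h i)" for h :: "nat \<Rightarrow> real"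
    using sum.permute[OF \<sigma>, of h] by (simp add: o_def)
  have "(\<Sum>i\<in>S. \<Sum>j\<in>S. (y (\<sigma> i) - y (\<sigma> j)) ^ 4) = (\<Sum>i\<in>S. \<Sum>j\<in>S. (y i - y j) ^ 4)"
    using perm[of "\<lambda>j. (y (\<sigma> i) - y j) ^ 4" for i] perm[of "\<lambda>i. \<Sum>j\<in>S. (y i - y j) ^ 4"] by simp
  moreover have "(\<Sum>i\<in>S. \<Sum>j\<in>S. \<bar>\<bar>x i - x j\<bar>\<^sup>2 - \<bar>y (\<sigma> i) - y (\<sigma> j)\<bar>\<^sup>2\<bar>\<^sup>2) =
    (\<Sum>i\<in>S. \<Sum>j\<in>S. (x i - x j) ^ 4) + (\<Sum>i\<in>S. \<Sum>j\<in>S. (y (\<sigma> i) - y (\<sigma> j)) ^ 4)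
    - 2 * (\<Sum>i\<in>S. \<Sum>j\<in>S. (x i - x j)\<^sup>2 * (y (\<sigma> i) - y (\<sigma> j))\<^sup>2)"
  proof -
    have "\<bar>\<bar>a\<bar>\<^sup>2 - \<bar>b\<bar>\<^sup>2\<bar>\<^sup>2 = a ^ 4 + b ^ 4 - 2 * (a\<^sup>2 * b\<^sup>2)" for a b :: real
      by (simp add: power2_eq_square power4_eq_xxxx algebra_simps)
    then show ?thesis
      by (simp add: sum.distrib sum_subtractf sum_distrib_left)
  qed
  moreover have "(\<Sum>i\<in>S. \<Sum>j\<in>S. (x i - x j)\<^sup>2 * (y (\<sigma> i) - y (\<sigma> j))\<^sup>2) =
    2 * n * (\<Sum>i\<in>S. (x i)\<^sup>2 * (y (\<sigma> i))\<^sup>2) + 2 * (\<Sum>i\<in>S. (x i)\<^sup>2) * (\<Sum>i\<in>S. (y i)\<^sup>2)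
    + 4 * (\<Sum>i\<in>S. x i * y (\<sigma> i))\<^sup>2"
    using sum_squared_difference_products[of x S "\<lambda>i. y (\<sigma> i)"] x y perm[of y] perm[of "\<lambda>i. (y i)\<^sup>2"]
    by (simp add: S_def)
  ultimately have "qap_objective n x y \<sigma> = 1 / (real n)\<^sup>2 *
      ((\<Sum>i\<in>S. \<Sum>j\<in>S. (x i - x j) ^ 4) + (\<Sum>i\<in>S. \<Sum>j\<in>S. (y i - y j) ^ 4)
        - 2 * (2 * n * (\<Sum>i\<in>S. (x i)\<^sup>2 * (y (\<sigma> i))\<^sup>2) + 2 * (\<Sum>i\<in>S. (x i)\<^sup>2) * (\<Sum>i\<in>S. (y i)\<^sup>2)
          + 4 * (\<Sum>i\<in>S. x i * y (\<sigma> i))\<^sup>2))"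
    unfolding qap_objective_def S_def[symmetric] by (simp only:)
  moreover have "1 / r\<^sup>2 * (a + b - 2 * (2 * r * v + 2 * p * q + 4 * u\<^sup>2)) =
      (a + b - 4 * p * q) / r\<^sup>2 - 4 * (v / r) - 8 * (u / r)\<^sup>2"
    if "r > 0" for r a b v p q u :: real
    using that by (simp add: field_simps power2_eq_square)
  ultimately show "qap_objective n x y \<sigma> =
      ((\<Sum>i=1..n. \<Sum>j=1..n. (x i - x j) ^ 4) + (\<Sum>i=1..n. \<Sum>j=1..n. (y i - y j) ^ 4)
        - 4 * (\<Sum>i=1..n. (x i)\<^sup>2) * (\<Sum>i=1..n. (y i)\<^sup>2)) / (real n)\<^sup>2
      - 4 * ((\<Sum>i=1..n. (x i)\<^sup>2 * (y (\<sigma> i))\<^sup>2) / n) - 8 * ((\<Sum>i=1..n. x i * y (\<sigma> i)) / n)\<^sup>2"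
    using n unfolding S_def[symmetric] by simp
qed

section \<open>Minimizers of the dual and of the assignment problem\<close>

theorem proposition3:
  fixes n :: nat and x y :: "nat \<Rightarrow> real" and \<mu> \<nu> :: "real measure"
  assumes "n \<ge> 1"
    and "strict_mono_on {1..n} x" and "strict_mono_on {1..n} y"
    and "(\<Sum>i=1..n. x i) = 0" and "(\<Sum>i=1..n. y i) = 0"
    and "\<mu> = empirical_measure n x" and "\<nu> = empirical_measure n y"
  shows "dual_minimizers \<mu> \<nu> \<subseteq> {0.5 * W_minus \<mu> \<nu>, 0.5 * W_plus \<mu> \<nu>}
     \<longleftrightarrow> qap_minimizers n x y \<subseteq> {id, anti_id n}"
proof -
  define S where "S = {1..n}"
  define U where "U \<sigma> = (\<Sum>i=1..n. x i * y (\<sigma> i)) / n" for \<sigma>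
  define V where "V \<sigma> = (\<Sum>i=1..n. (x i)\<^sup>2 * (y (\<sigma> i))\<^sup>2) / n" for \<sigma>
  define g where "g \<sigma> = - 4 * V \<sigma> - 8 * (U \<sigma>)\<^sup>2" for \<sigma>
  define D where "D = dual_objective \<mu> \<nu>"
  have inj: "inj_on x {1..n}" "inj_on y {1..n}"
    using assms(2,3) by (auto intro: strict_mono_on_imp_inj_on)
  note attained = INF_couplings_attained[OF assms(1) inj, folded assms(6,7) S_def]
  have n: "real n > 0" using assms(1) by simp
  have idS: "id permutes S" by (rule permutes_id)
  have antiS: "anti_id n permutes S" unfolding S_def by (rule anti_id_permutes)

  have U_id: "U \<sigma> < U id" if "\<sigma> permutes S" "\<sigma> \<noteq> id" for \<sigma>
    using rearrangement_strict[OF _ assms(2,3)] that n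
    by (simp add: U_def S_def divide_strict_right_mono)
  have U_anti: "U (anti_id n) < U \<sigma>" if "\<sigma> permutes S" "\<sigma> \<noteq> anti_id n" for \<sigma>
    using rearrangement_strict_anti[OF assms(2,3)] that n
    by (simp add: U_def S_def divide_strict_right_mono)

  have meas_U: "(\<lambda>(a, b). a * b :: real) \<in> borel_measurable borel"
    by (simp add: borel_prod[symmetric])
  have mean_U: "permutation_mean n x y (\<lambda>(a, b). a * b) \<sigma> = U \<sigma>" for \<sigma>
    by (simp add: permutation_mean_def U_def)
  have W_minus: "W_minus \<mu> \<nu> = U (anti_id n)"
  proof -
    obtain \<sigma> where "\<sigma> permutes S" "W_minus \<mu> \<nu> = U \<sigma>" "U \<sigma> \<le> U (anti_id n)"
      using attained[OF meas_U] antiS unfolding W_minus_def mean_U by metis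
    then show ?thesis using U_anti by (metis not_less)
  qed
  have W_plus: "W_plus \<mu> \<nu> = U id"
  proof -
    have meas: "(\<lambda>(a, b). - (a * b) :: real) \<in> borel_measurable borel"
      by (simp add: borel_prod[symmetric])
    have mean: "permutation_mean n x y (\<lambda>(a, b). - (a * b)) \<sigma> = - U \<sigma>" for \<sigma>
      by (simp add: permutation_mean_def U_def sum_negf)
    obtain \<sigma> where \<sigma>: "\<sigma> permutes S" "U id \<le> U \<sigma>"
        "(INF \<pi>\<in>couplings \<mu> \<nu>. \<integral>(a, b). - (a * b) \<partial>\<pi>) = - U \<sigma>"
      using attained[OF meas] idS unfolding mean neg_le_iff_le by metis
    moreover have "(\<integral>(a, b). - (a * b) \<partial>\<pi>) = - (\<integral>(a, b). a * b \<partial>\<pi>)" for \<pi> :: "(real \<times> real) measure"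
      by (simp add: case_prod_unfold)
    ultimately have "W_plus \<mu> \<nu> = U \<sigma>"
      unfolding W_plus_def by (simp add: Inf_real_def image_image)
    then show ?thesis using U_id \<sigma>(1,2) by (metis not_less)
  qed

  \<comment> \<open>\<open>D a\<close> is the minimum over \<open>\<sigma>\<close> of \<open>g \<sigma> + 32 * (a - U \<sigma> / 2)\<^sup>2\<close>, by completing the square.\<close>
  have D: "\<exists>\<sigma>. \<sigma> permutes S \<and> D a = g \<sigma> + 32 * (a - U \<sigma> / 2)\<^sup>2"
    and D_le: "\<sigma> permutes S \<Longrightarrow> D a \<le> g \<sigma> + 32 * (a - U \<sigma> / 2)\<^sup>2" for a \<sigma>
  proof -
    have meas: "(\<lambda>(p, q). - 4 * p\<^sup>2 * q\<^sup>2 - 32 * a * p * q :: real) \<in> borel_measurable borel"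
      by (simp add: borel_prod[symmetric])
    have mean: "32 * a\<^sup>2 + permutation_mean n x y (\<lambda>(p, q). - 4 * p\<^sup>2 * q\<^sup>2 - 32 * a * p * q) \<sigma> =
        g \<sigma> + 32 * (a - U \<sigma> / 2)\<^sup>2" for \<sigma>
    proof -
      have "permutation_mean n x y (\<lambda>(p, q). - 4 * p\<^sup>2 * q\<^sup>2 - 32 * a * p * q) \<sigma> =
          - 4 * V \<sigma> - 32 * a * U \<sigma>"
        by (simp add: permutation_mean_def U_def V_def sum_subtractf sum_negf sum_distrib_left
          diff_divide_distrib mult.assoc)
      then show ?thesis by (simp add: g_def power2_eq_square algebra_simps)
    qed
    obtain \<rho> where \<rho>: "\<rho> permutes S" "D a = g \<rho> + 32 * (a - U \<rho> / 2)\<^sup>2"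
      "\<And>\<tau>. \<tau> permutes S \<Longrightarrow> g \<rho> + 32 * (a - U \<rho> / 2)\<^sup>2 \<le> g \<tau> + 32 * (a - U \<tau> / 2)\<^sup>2"
    proof (rule attained[OF meas])
      fix \<rho> assume \<rho>: "\<rho> permutes S" and "(INF \<pi>\<in>couplings \<mu> \<nu>. \<integral>(p, q). - 4 * p\<^sup>2 * q\<^sup>2 - 32 * a * p * q \<partial>\<pi>) =
          permutation_mean n x y (\<lambda>(p, q). - 4 * p\<^sup>2 * q\<^sup>2 - 32 * a * p * q) \<rho>"
      then have "D a = g \<rho> + 32 * (a - U \<rho> / 2)\<^sup>2"
        using mean[of \<rho>] by (simp only: D_def dual_objective_def)
      moreover assume "\<And>\<tau>. \<tau> permutes S \<Longrightarrow>
          permutation_mean n x y (\<lambda>(p, q). - 4 * p\<^sup>2 * q\<^sup>2 - 32 * a * p * q) \<rho> \<le>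
          permutation_mean n x y (\<lambda>(p, q). - 4 * p\<^sup>2 * q\<^sup>2 - 32 * a * p * q) \<tau>"
      then have "g \<rho> + 32 * (a - U \<rho> / 2)\<^sup>2 \<le> g \<tau> + 32 * (a - U \<tau> / 2)\<^sup>2" if "\<tau> permutes S" for \<tau>
        unfolding mean[symmetric] using that by simp
      ultimately show ?thesis using that \<rho> by blast
    qed
    then show "\<exists>\<sigma>. \<sigma> permutes S \<and> D a = g \<sigma> + 32 * (a - U \<sigma> / 2)\<^sup>2"
      "\<sigma> permutes S \<Longrightarrow> D a \<le> g \<sigma> + 32 * (a - U \<sigma> / 2)\<^sup>2" by auto
  qed

  obtain C where C: "\<And>\<sigma>. \<sigma> permutes S \<Longrightarrow> qap_objective n x y \<sigma> = C + g \<sigma>"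
  proof (rule qap_objective_eq[OF assms(1,4,5)])
    fix C assume "\<And>\<sigma>. \<sigma> permutes {1..n} \<Longrightarrow> qap_objective n x y \<sigma> =
      C - 4 * ((\<Sum>i=1..n. (x i)\<^sup>2 * (y (\<sigma> i))\<^sup>2) / n) - 8 * ((\<Sum>i=1..n. x i * y (\<sigma> i)) / n)\<^sup>2"
    then have "qap_objective n x y \<sigma> = C + g \<sigma>" if "\<sigma> permutes S" for \<sigma>
      using that by (simp add: g_def U_def V_def S_def)
    then show ?thesis using that by blast
  qed
  have qap: "\<sigma> \<in> qap_minimizers n x y \<longleftrightarrow> \<sigma> permutes S \<and> (\<forall>\<tau>. \<tau> permutes S \<longrightarrow> g \<sigma> \<le> g \<tau>)" for \<sigma>
    unfolding qap_minimizers_def is_arg_min_def S_def[symmetric] using C by (auto simp: not_less)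
  define I where "I = {0.5 * U (anti_id n) .. 0.5 * U id}"
  have UI: "U \<sigma> / 2 \<in> I" if "\<sigma> permutes S" for \<sigma>
    using U_id[OF that] U_anti[OF that] by (fastforce simp: I_def)
  have dual: "a \<in> dual_minimizers \<mu> \<nu> \<longleftrightarrow> a \<in> I \<and> (\<forall>b\<in>I. D a \<le> D b)" for a
    unfolding dual_minimizers_def is_arg_min_def W_minus W_plus D_def I_def by (auto simp: not_less)
  have D_half: "D (U \<sigma> / 2) \<le> g \<sigma>" if "\<sigma> permutes S" for \<sigma>
    using D_le[OF that, of "U \<sigma> / 2"] by simp

  have eq: "dual_minimizers \<mu> \<nu> = (\<lambda>\<sigma>. U \<sigma> / 2) ` qap_minimizers n x y"
  proof (intro equalityI subsetI)
    fix a assume "a \<in> dual_minimizers \<mu> \<nu>"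
    then have a: "\<And>\<tau>. \<tau> permutes S \<Longrightarrow> D a \<le> g \<tau>"
      using dual UI D_half by (meson order_trans)
    obtain \<sigma> where \<sigma>: "\<sigma> permutes S" "D a = g \<sigma> + 32 * (a - U \<sigma> / 2)\<^sup>2"
      using D by blast
    then have "(a - U \<sigma> / 2)\<^sup>2 = 0" using a[OF \<sigma>(1)] zero_le_power2[of "a - U \<sigma> / 2"] by linarith
    then have "a = U \<sigma> / 2" "D a = g \<sigma>" using \<sigma>(2) by simp_all
    then show "a \<in> (\<lambda>\<sigma>. U \<sigma> / 2) ` qap_minimizers n x y"
      using \<sigma>(1) a qap by auto
  next
    fix a assume "a \<in> (\<lambda>\<sigma>. U \<sigma> / 2) ` qap_minimizers n x y"
    then obtain \<sigma> where \<sigma>: "\<sigma> permutes S" "\<And>\<tau>. \<tau> permutes S \<Longrightarrow> g \<sigma> \<le> g \<tau>" and a: "a = U \<sigma> / 2"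
      using qap by auto
    have "D a \<le> D b" for b
    proof -
      obtain \<tau> where \<tau>: "\<tau> permutes S" "D b = g \<tau> + 32 * (b - U \<tau> / 2)\<^sup>2"
        using D by blast
      have "D a \<le> g \<sigma>" unfolding a by (rule D_half[OF \<sigma>(1)])
      also have "\<dots> \<le> g \<tau>" by (rule \<sigma>(2)[OF \<tau>(1)])
      also have "\<dots> \<le> D b" using \<tau>(2) by simp
      finally show ?thesis .
    qed
    then show "a \<in> dual_minimizers \<mu> \<nu>" using dual UI \<sigma>(1) a by blast
  qed
  have "U \<sigma> / 2 \<in> {0.5 * U (anti_id n), 0.5 * U id} \<longleftrightarrow> \<sigma> \<in> {id, anti_id n}"
    if "\<sigma> \<in> qap_minimizers n x y" for \<sigma>
  proof -
    have "\<sigma> permutes S" using that qap by blast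
    then show ?thesis using U_id[of \<sigma>] U_anti[of \<sigma>] by auto
  qed
  then show ?thesis
    unfolding eq W_minus W_plus image_subset_iff by blast
qed

end
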